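(* Let $n\ge 3$. Let $O_k,E_k$ ($k\in\{1,\dots,\lfloor n/2\rfloor\}\cup\{n\}$) be the pentagram invariants, polynomials in $x_1,\dots,x_{2n}$, and let $\alpha_1,\alpha_2$ be the rational maps in the variables $(x_1,\dots,x_{2n})$ defined in the context. Then, as identities of rational functions, $$O_k\circ\alpha_j=E_k,\qquad E_k\circ\alpha_j=O_k$$ for $j=1,2$ and for all $k$.
   Context: All indices are taken mod $2n$. The map $\alpha_1(x_1,\dots,x_{2n})=(x_1',\dots,x_{2n}')$ is $$x_{2k-1}'=x_{2k}\frac{1-x_{2k+1}x_{2k+2}}{1-x_{2k-3}x_{2k-2}},\qquad x_{2k}'=x_{2k-1}\frac{1-x_{2k-3}x_{2k-2}}{1-x_{2k+1}x_{2k+2}},$$ and $\alpha_2(x_1,\dots,x_{2n})=(x_1'',\dots,x_{2n}'')$ is $$x_{2k+1}''=x_{2k}\frac{1-x_{2k-2}x_{2k-1}}{1-x_{2k+2}x_{2k+3}},\qquad x_{2k}''=x_{2k+1}\frac{1-x_{2k+2}x_{2k+3}}{1-x_{2k-2}x_{2k-1}}.$$ Pentagram invariants. Indices lie in $\{1,\dots,2n\}$, taken cyclically mod $2n$. An odd unit is a set $\{j\}$ with $j$ odd, or $\{k-1,k,k+1\}$ with $k$ even. Two odd units are consecutive if the odd numbers in their union form a set of (cyclically) consecutive odd numbers. An odd admissible subset $S$ is a nonempty union of odd units no two of which are consecutive; its weight is the number of its units, and $\mathrm{sign}(S)=+1$ or $-1$ according to whether the number of singleton units is even or odd. For $1\le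 k\le\lfloor n/2\rfloor$, $O_k=\sum_S \mathrm{sign}(S)\prod_{j\in S}x_j$ over odd admissible $S$ of weight $k$; also $O_n=x_1x_3\cdots x_{2n-1}$. The $E_k$ are defined in the same way with the words odd and even interchanged ($E_n=x_2x_4\cdots x_{2n}$). *)

theory Defs
  imports "HOL-Library.Poly_Mapping" "HOL-Computational_Algebra.Fraction_Field"
begin

text \<open>
  Rational functions over \<open>'a\<close> in indeterminates indexed by the integers: the fraction field of the
  polynomial ring, a polynomial being a finitely supported map from monomials to coefficients.
  Only the indeterminates with index in \<open>{1..2 * n}\<close> are ever used below.
\<close>

type_synonym 'a ratfun = "((int \<Rightarrow>\<^sub>0 nat) \<Rightarrow>\<^sub>0 'a) fract"

definition indet :: "int \<Rightarrow> 'a::field ratfun"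
  where "indet i = Fract (Poly_Mapping.single (Poly_Mapping.single i 1) 1) 1"

text \<open>The representative in \<open>{1..2 * n}\<close> of the index \<open>i\<close> mod \<open>2 * n\<close>.\<close>

definition cyc :: "nat \<Rightarrow> int \<Rightarrow> int"
  where "cyc n i = (i - 1) mod (2 * int n) + 1"


subsection \<open>The maps\<close>

text \<open>
  In each branch \<open>k\<close> is determined by the position \<open>j\<close>: for \<open>\<alpha>\<^sub>1\<close> one has \<open>j = 2 * k - 1\<close> or
  \<open>j = 2 * k\<close>, for \<open>\<alpha>\<^sub>2\<close> one has \<open>j = 2 * k + 1\<close> or \<open>j = 2 * k\<close>.
\<close>

definition alpha1 :: "nat \<Rightarrow> (int \<Rightarrow> 'b::field) \<Rightarrow> int \<Rightarrow> 'b"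
  where "alpha1 n x' j =
    (let x = (\<lambda>i. x' (cyc n i)) in
     if odd j then
       let k = (j + 1) div 2 in
         x (2*k) * ((1 - x (2*k+1) * x (2*k+2)) / (1 - x (2*k-3) * x (2*k-2)))
     else
       let k = j div 2 in
         x (2*k-1) * ((1 - x (2*k-3) * x (2*k-2)) / (1 - x (2*k+1) * x (2*k+2))))"

definition alpha2 :: "nat \<Rightarrow> (int \<Rightarrow> 'b::field) \<Rightarrow> int \<Rightarrow> 'b"
  where "alpha2 n x' j =
    (let x = (\<lambda>i. x' (cyc n i)) in
     if odd j then
       let k = (j - 1) div 2 in
         x (2*k) * ((1 - x (2*k-2) * x (2*k-1)) / (1 - x (2*k+2) * x (2*k+3)))
     else
       let k = j div 2 in
         x (2*k+1) * ((1 - x (2*k+2) * x (2*k+3)) / (1 - x (2*k-2) * x (2*k-1))))"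


subsection \<open>The pentagram invariants\<close>

text \<open>
  The parameter \<open>P\<close> is \<open>odd\<close> for the invariants \<open>O\<^sub>k\<close> and \<open>even\<close> for the \<open>E\<^sub>k\<close>.
  Reduction by \<^const>\<open>cyc\<close> preserves parity.
\<close>

definition units :: "(int \<Rightarrow> bool) \<Rightarrow> nat \<Rightarrow> int set set"
  where "units P n =
    {{j} | j. j \<in> {1..2 * int n} \<and> P j} \<union>
    {{cyc n (k - 1), k, cyc n (k + 1)} | k. k \<in> {1..2 * int n} \<and> \<not> P k}"

definition cyclic_run :: "(int \<Rightarrow> bool) \<Rightarrow> nat \<Rightarrow> int set \<Rightarrow> bool"
  where "cyclic_run P n A \<longleftrightarrow>
    (\<exists>a m. P a \<and> A = (\<lambda>i. cyc n (a + 2 * int i)) ` {..<m::nat})"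

definition consecutive :: "(int \<Rightarrow> bool) \<Rightarrow> nat \<Rightarrow> int set \<Rightarrow> int set \<Rightarrow> bool"
  where "consecutive P n u v \<longleftrightarrow> cyclic_run P n {j \<in> u \<union> v. P j}"

definition decomposes :: "(int \<Rightarrow> bool) \<Rightarrow> nat \<Rightarrow> int set set \<Rightarrow> int set \<Rightarrow> bool"
  where "decomposes P n U S \<longleftrightarrow>
    U \<noteq> {} \<and> U \<subseteq> units P n \<and>
    (\<forall>u\<in>U. \<forall>v\<in>U. u \<noteq> v \<longrightarrow> \<not> consecutive P n u v) \<and> S = \<Union> U"

definition admissible :: "(int \<Rightarrow> bool) \<Rightarrow> nat \<Rightarrow> int set \<Rightarrow> bool"
  where "admissible P n S \<longleftrightarrow> (\<exists>U. decomposes P n U S)"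

text \<open>
  The units of an admissible set. For \<open>n \<ge> 3\<close> they are determined by the set, because units that
  overlap or touch are consecutive.
\<close>

definition units_of_set :: "(int \<Rightarrow> bool) \<Rightarrow> nat \<Rightarrow> int set \<Rightarrow> int set set"
  where "units_of_set P n S = (THE U. decomposes P n U S)"

definition weight :: "(int \<Rightarrow> bool) \<Rightarrow> nat \<Rightarrow> int set \<Rightarrow> nat"
  where "weight P n S = card (units_of_set P n S)"

definition sgn_of_set :: "(int \<Rightarrow> bool) \<Rightarrow> nat \<Rightarrow> int set \<Rightarrow> 'b::comm_ring_1"
  where "sgn_of_set P n S = (-1) ^ card {u \<in> units_of_set P n S. is_singleton u}"

text \<open>
  The polynomial is given by its values at tuples \<open>x\<close> in an arbitrary commutative ring; composing
  with a rational map is then evaluation at the tuple of component functions of that map.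
\<close>

definition pent_inv :: "(int \<Rightarrow> bool) \<Rightarrow> nat \<Rightarrow> nat \<Rightarrow> (int \<Rightarrow> 'b::comm_ring_1) \<Rightarrow> 'b"
  where "pent_inv P n k x =
    (if k = n then \<Prod>j | j \<in> {1..2 * int n} \<and> P j. x j
     else \<Sum>S | admissible P n S \<and> weight P n S = k. sgn_of_set P n S * (\<Prod>j\<in>S. x j))"

definition pent_O :: "nat \<Rightarrow> nat \<Rightarrow> (int \<Rightarrow> 'b::comm_ring_1) \<Rightarrow> 'b"
  where "pent_O = pent_inv odd"

definition pent_E :: "nat \<Rightarrow> nat \<Rightarrow> (int \<Rightarrow> 'b::comm_ring_1) \<Rightarrow> 'b"
  where "pent_E = pent_inv even"


subsection \<open>Well-formedness checks\<close>

text \<open>No denominator occurring in the two maps vanishes as a rational function.\<close>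

lemma one_minus_indet_mult_indet_neq_0: "1 - indet i * indet j \<noteq> (0 :: 'a::field ratfun)"
proof
  let ?m = "Poly_Mapping.single i 1 + Poly_Mapping.single j (1::nat)"
  assume "1 - indet i * indet j = (0 :: 'a ratfun)"
  then have "indet i * indet j = (1 :: 'a ratfun)"
    by simp
  then have "Fract (Poly_Mapping.single ?m (1::'a)) 1 = Fract 1 1"
    by (simp only: indet_def mult_fract mult_single One_fract_def mult_1_right)
  then have "Poly_Mapping.single ?m (1::'a) = Poly_Mapping.single 0 1"
    by (simp add: eq_fract)
  then have "?m = 0"
    by (metis lookup_single_eq lookup_single_not_eq zero_neq_one)
  then have "Poly_Mapping.lookup ?m i = 0"
    by (simp only: lookup_zero)
  then show False
    by (simp add: lookup_add)
qed

lemma finite_admissible: "finite {S. admissible P n S}"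
proof (cases "n = 0")
  case True
  then have "units P n = {}" by (auto simp: units_def)
  then show ?thesis by (auto simp: admissible_def decomposes_def)
next
  case False
  then have "cyc n i \<in> {1..2 * int n}" for i
  proof -
    have "0 \<le> (i - 1) mod (2 * int n)" "(i - 1) mod (2 * int n) < 2 * int n"
      using False by simp_all
    then show ?thesis by (simp add: cyc_def)
  qed
  then have "units P n \<subseteq> Pow {1..2 * int n}"
    unfolding units_def by blast
  then have "{S. admissible P n S} \<subseteq> Pow {1..2 * int n}"
    unfolding admissible_def decomposes_def by blast
  then show ?thesis
    by (rule finite_subset) simp
qed

end

theory Submission
  imports Defs
begin

text \<open>
  Orient the cycle by a step \<open>s = \<plusminus>1\<close> and anchor the unit \<open>{j, j + s, j + 2 * s}\<close> at \<open>j\<close>. An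
  admissible set amounts to the set \<open>J\<close> of anchors of its units, no two of which differ by \<open>2\<close>,
  together with the choice, at each \<open>j \<in> J\<close> with \<open>j + 4 * s \<notin> J\<close>, of a singleton or a triple.
  Summing over these choices gives, for either orientation,
  \<open>(\<Sum>J. (\<Prod>j\<in>J. - x j) * (\<Prod>j \<in> J with j + 4 * s \<notin> J. 1 - x (j + s) * x (j + 2 * s)))\<close>.
  Let \<open>y\<close> be the image of \<open>x\<close> under \<open>\<alpha>\<^sub>1\<close> or \<open>\<alpha>\<^sub>2\<close>. Up to the factor \<open>x (j + s)\<close>, the value
  \<open>y j\<close> is \<open>c j / c (j - 4 * s)\<close> with \<open>c j = 1 - x (j + 2 * s) * x (j + 3 * s)\<close>. Expanding the
  invariant of \<open>y\<close> with orientation \<open>- s\<close> and that of \<open>x\<close> (other parity) with orientation \<open>s\<close>,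
  the terms of \<open>J\<close> and \<open>J + s\<close> agree, because the factors \<open>c\<close> cancel along maximal runs of step \<open>4\<close> in \<open>J\<close>.
\<close>

subsection \<open>Units on the oriented cycle\<close>

lemma cyc_cong_iff: "cyc n i = cyc n j \<longleftrightarrow> 2 * int n dvd i - j"
proof -
  have "cyc n i = cyc n j \<longleftrightarrow> (i - 1) mod (2 * int n) = (j - 1) mod (2 * int n)"
    by (simp add: cyc_def)
  also have "\<dots> \<longleftrightarrow> 2 * int n dvd (i - 1) - (j - 1)"
    by (simp add: mod_eq_dvd_iff)
  finally show ?thesis by simp
qed

lemma cyc_eq_self: "j \<in> {1..2 * int n} \<Longrightarrow> cyc n j = j"
  by (simp add: cyc_def)

lemma cyc_in_range: "n > 0 \<Longrightarrow> cyc n i \<in> {1..2 * int n}"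
  using pos_mod_bound[of "2 * int n" "i - 1"] pos_mod_sign[of "2 * int n" "i - 1"]
  unfolding cyc_def atLeastAtMost_iff by linarith

text \<open>Inner reductions disappear, so that iterated shifts such as \<open>nxt (nxt j)\<close>
  simplify to a single reduced shift.\<close>

lemma cyc_add_left [simp]: "cyc n (cyc n i + d) = cyc n (i + d)"
proof -
  have "cyc n i - i = - (2 * int n * ((i - 1) div (2 * int n)))"
    unfolding cyc_def minus_div_mult_eq_mod[symmetric] by simp
  then have "2 * int n dvd (cyc n i + d) - (i + d)"
    by simp
  then show ?thesis by (simp only: cyc_cong_iff)
qed

lemma cyc_add_right [simp]: "cyc n (d + cyc n i) = cyc n (d + i)"
  using cyc_add_left[of n i d] by (simp only: add.commute)

lemma cyc_diff_left [simp]: "cyc n (cyc n i - d) = cyc n (i - d)"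
  using cyc_add_left[of n i "- d"] by simp

lemma cyc_cyc [simp]: "cyc n (cyc n i) = cyc n i"
  using cyc_add_left[of n i 0] by simp

lemma even_cyc [simp]: "even (cyc n i) \<longleftrightarrow> even i"
proof -
  have "2 * int n dvd cyc n i - i"
    by (simp flip: cyc_cong_iff)
  then have "even (cyc n i - i)"
    using dvd_mult_left by blast
  then show ?thesis by simp
qed

text \<open>Orientation and parity are both left open, so that the same expansion can be
  instantiated at \<open>- s\<close> and at the opposite parity.\<close>

locale oriented_cycle =
  fixes n :: nat and s :: int and P :: "int \<Rightarrow> bool"
  assumes n_ge_3: "n \<ge> 3"
    and step: "s = 1 \<or> s = -1"
    and parity: "P = odd \<or> P = even"
begin

definition points :: "int set"
  where "points = {j \<in> {1..2 * int n}. P j}"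

definition mid :: "int \<Rightarrow> int"
  where "mid j = cyc n (j + s)"

definition nxt :: "int \<Rightarrow> int"
  where "nxt j = cyc n (j + 2 * s)"

text \<open>\<open>D\<close> collects the anchors that carry a triple; every other anchor carries a
  singleton.\<close>

definition unit_at :: "int set \<Rightarrow> int \<Rightarrow> int set"
  where "unit_at D j = (if j \<in> D then {j, mid j, nxt j} else {j})"

text \<open>Independent sets of the cycle graph on \<open>points\<close> whose edges join
  \<open>j\<close> to \<open>nxt j\<close>.\<close>

definition indep :: "int set set"
  where "indep = {J. J \<subseteq> points \<and> (\<forall>j\<in>J. nxt j \<notin> J)}"

text \<open>The anchors at which a triple is allowed: the triple reaches \<open>nxt j\<close>, so a
  unit anchored at \<open>nxt (nxt j)\<close> would touch it.\<close>

definition free_anchors :: "int set \<Rightarrow> int set"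
  where "free_anchors J = {j \<in> J. nxt (nxt j) \<notin> J}"

lemma P_add_even: "even d \<Longrightarrow> P (i + d) = P i"
  using parity by auto

lemma P_cyc [simp]: "P (cyc n i) = P i"
  using parity by auto

lemma P_step: "P (i + s) = (\<not> P i)"
  using parity step by auto

lemma finite_points [simp]: "finite points"
  by (rule finite_subset[of _ "{1..2 * int n}"]) (auto simp: points_def)

lemma points_cyc: "j \<in> points \<Longrightarrow> cyc n j = j"
  by (simp add: points_def cyc_eq_self)

lemma cyc_points: "P i \<Longrightarrow> cyc n i \<in> points"
  using n_ge_3 cyc_in_range[of n i] by (simp add: points_def)

lemma P_points: "j \<in> points \<Longrightarrow> P j"
  by (simp add: points_def)

lemma not_P_mid: "j \<in> points \<Longrightarrow> \<not> P (mid j)"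
  by (simp add: mid_def P_step points_def)

lemma nxt_points: "j \<in> points \<Longrightarrow> nxt j \<in> points"
  unfolding nxt_def by (rule cyc_points) (simp add: P_add_even points_def)

lemma cyc_shift_inj: "inj_on (\<lambda>j. cyc n (j + d)) points"
proof (rule inj_onI)
  fix i j assume ij: "i \<in> points" "j \<in> points" and "cyc n (i + d) = cyc n (j + d)"
  then have "cyc n i = cyc n j" by (simp add: cyc_cong_iff)
  with ij show "i = j" by (simp add: points_cyc)
qed

lemma mid_eq_iff: "i \<in> points \<Longrightarrow> j \<in> points \<Longrightarrow> mid i = mid j \<longleftrightarrow> i = j"
  unfolding mid_def using cyc_shift_inj[of s] by (auto dest: inj_onD)

lemma nxt_eq_iff: "i \<in> points \<Longrightarrow> j \<in> points \<Longrightarrow> nxt i = nxt j \<longleftrightarrow> i = j"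
  unfolding nxt_def using cyc_shift_inj[of "2 * s"] by (auto dest: inj_onD)

lemma nxt_nxt: "nxt (nxt j) = cyc n (j + 4 * s)"
  by (simp add: nxt_def algebra_simps)

lemma cyc_shift_neq:
  assumes "j \<in> points" "d \<noteq> 0" "\<bar>d\<bar> < 2 * int n"
  shows "cyc n (j + d) \<noteq> j"
proof
  assume "cyc n (j + d) = j"
  then have "cyc n (j + d) = cyc n j" using assms by (simp add: points_cyc)
  then have "2 * int n dvd d" by (simp add: cyc_cong_iff)
  then have "\<bar>2 * int n\<bar> \<le> \<bar>d\<bar>" using \<open>d \<noteq> 0\<close> by (rule dvd_imp_le_int[rotated])
  with assms show False by simp
qed

lemma nxt_neq: "j \<in> points \<Longrightarrow> nxt j \<noteq> j"
  unfolding nxt_def using n_ge_3 step by (intro cyc_shift_neq) auto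

text \<open>Here \<open>n \<ge> 3\<close> enters as \<open>4 < 2 * n\<close>; for
  \<open>n = 2\<close> a shift by 4 would be the identity.\<close>

lemma nxt_nxt_neq: "j \<in> points \<Longrightarrow> nxt (nxt j) \<noteq> j"
  unfolding nxt_nxt using n_ge_3 step by (intro cyc_shift_neq) auto

lemma units_eq: "units P n = (\<lambda>j. {j}) ` points \<union> (\<lambda>j. {j, mid j, nxt j}) ` points"
proof -
  have "{{cyc n (k - 1), k, cyc n (k + 1)} | k. k \<in> {1..2 * int n} \<and> \<not> P k}
      = (\<lambda>j. {j, mid j, nxt j}) ` points" (is "?L = ?R")
  proof (intro equalityI subsetI)
    fix u assume "u \<in> ?L"
    then obtain k where k: "k \<in> {1..2 * int n}" "\<not> P k"
      and u: "u = {cyc n (k - 1), k, cyc n (k + 1)}" by blast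
    \<comment> \<open>The triple centred at \<open>k\<close> is anchored one step back, at
      \<open>k - s\<close>; the sign of \<open>s\<close> decides which of its two ends that
      is.\<close>
    have "P (k - s)" using P_step[of "k - s"] k by simp
    then have "cyc n (k - s) \<in> points" by (rule cyc_points)
    moreover have "u = {cyc n (k - s), mid (cyc n (k - s)), nxt (cyc n (k - s))}"
      using step k unfolding u mid_def nxt_def by (auto simp: cyc_eq_self add.commute)
    ultimately show "u \<in> ?R" by blast
  next
    fix u assume "u \<in> ?R"
    then obtain j where j: "j \<in> points" and u: "u = {j, mid j, nxt j}" by blast
    have "mid j \<in> {1..2 * int n}" "\<not> P (mid j)"
      using cyc_in_range[of n] n_ge_3 not_P_mid[OF j] by (simp_all add: mid_def)
    moreover have "u = {cyc n (mid j - 1), mid j, cyc n (mid j + 1)}"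
      using step points_cyc[OF j] unfolding u mid_def nxt_def by (auto simp: add.commute)
    ultimately show "u \<in> ?L" by blast
  qed
  moreover have "{{j} | j. j \<in> {1..2 * int n} \<and> P j} = (\<lambda>j. {j}) ` points"
    by (auto simp: points_def)
  ultimately show ?thesis by (simp add: units_def)
qed

section \<open>Runs of points of one parity\<close>

lemma cyclic_run_oriented:
  assumes "j \<in> points"
  shows "cyclic_run P n ((\<lambda>i. cyc n (j + 2 * s * int i)) ` {..<m})"
proof (cases "s = 1")
  case True
  with assms show ?thesis by (auto simp: cyclic_run_def points_def)
next
  case False
  then have s: "s = -1" using step by simp
  \<comment> \<open>\<open>cyclic_run\<close> enumerates upwards, so for \<open>s = -1\<close> the
    run is read from its other end, \<open>j - 2 * (m - 1)\<close>.\<close>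
  let ?a = "j + 2 - 2 * int m"
  have "(\<lambda>i. cyc n (j + 2 * s * int i)) ` {..<m} = (\<lambda>i. cyc n (?a + 2 * int i)) ` {..<m}"
    (is "?f ` _ = ?g ` _")
  proof -
    have "?f ` {..<m} = (?g \<circ> (\<lambda>i. m - Suc i)) ` {..<m}"
      by (rule image_cong) (auto simp: s of_nat_diff algebra_simps)
    also have "\<dots> = ?g ` ((\<lambda>i. m - Suc i) ` {..<m})" by (simp add: image_comp)
    also have "(\<lambda>i. m - Suc i) ` {..<m} = {..<m}"
    proof (intro equalityI subsetI)
      fix i assume "i \<in> {..<m}"
      then show "i \<in> (\<lambda>i. m - Suc i) ` {..<m}"
        by (intro image_eqI[of _ _ "m - Suc i"]) auto
    qed auto
    finally show ?thesis .
  qed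
  moreover have "P ?a"
    using P_add_even[of "2 - 2 * int m" j] P_points[OF assms] by (simp add: algebra_simps)
  ultimately show ?thesis unfolding cyclic_run_def by blast
qed

text \<open>These runs are the \<open>P\<close>-parts of the clashing pairs of units treated
  below.\<close>

lemma cyclic_run_upto_4:
  assumes "j \<in> points"
  shows "cyclic_run P n {j, nxt j}"
    and "cyclic_run P n {j, nxt j, nxt (nxt j)}"
    and "cyclic_run P n {j, nxt j, nxt (nxt j), nxt (nxt (nxt j))}"
proof -
  have [simp]: "cyc n j = j" using assms by (rule points_cyc)
  have "{..<2} = {0, 1::nat}" "{..<3} = {0, 1, 2::nat}" "{..<4} = {0, 1, 2, 3::nat}" by auto
  with cyclic_run_oriented[OF assms, of 2] cyclic_run_oriented[OF assms, of 3]
    cyclic_run_oriented[OF assms, of 4]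
  show "cyclic_run P n {j, nxt j}"
    and "cyclic_run P n {j, nxt j, nxt (nxt j)}"
    and "cyclic_run P n {j, nxt j, nxt (nxt j), nxt (nxt (nxt j))}"
    by (simp_all add: nxt_def algebra_simps)
qed

text \<open>A union of two units that are not consecutive has two last elements, so it is not a run.\<close>

lemma cyclic_run_unique_last:
  assumes "cyclic_run P n A" "e \<in> A" "nxt e \<notin> A" "e' \<in> A" "nxt e' \<notin> A"
  shows "e = e'"
proof -
  obtain a m where A: "A = (\<lambda>i. cyc n (a + 2 * int i)) ` {..<m::nat}"
    using assms(1) by (auto simp: cyclic_run_def)
  \<comment> \<open>The last element has index \<open>m - 1\<close> when the orientation follows the
    enumeration and index \<open>0\<close> when it opposes it; at any other index the successor is
    again in \<open>A\<close>.\<close>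
  have last: "f = cyc n (a + 2 * (if s = 1 then int m - 1 else 0))" if f: "f \<in> A" "nxt f \<notin> A" for f
  proof -
    obtain i where i: "i < m" "f = cyc n (a + 2 * int i)" using f(1) A by auto
    have nxt: "nxt f = cyc n (a + 2 * (int i + s))"
      by (simp add: nxt_def i algebra_simps)
    show ?thesis
    proof (cases "s = 1")
      case True
      have "\<not> Suc i < m"
      proof
        assume "Suc i < m"
        then have "nxt f \<in> A"
          unfolding A nxt by (intro image_eqI[of _ _ "Suc i"]) (auto simp: True algebra_simps)
        with f show False by simp
      qed
      with i have "int i = int m - 1" by linarith
      with i True show ?thesis by simp
    next
      case False
      then have s: "s = -1" using step by simp
      have "i = 0"
      proof (rule ccontr)
        assume "i \<noteq> 0"
        with i have "nxt f \<in> A"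
          unfolding A nxt by (intro image_eqI[of _ _ "i - 1"]) (auto simp: s of_nat_diff algebra_simps)
        with f show False by simp
      qed
      with i False show ?thesis by simp
    qed
  qed
  show ?thesis using last[of e] last[of e'] assms by simp
qed

subsection \<open>Admissible sets\<close>

lemma unit_at_P: "j \<in> points \<Longrightarrow> {i \<in> unit_at D j. P i} = (if j \<in> D then {j, nxt j} else {j})"
  using not_P_mid[of j] P_points[of j] P_points[OF nxt_points[of j]] by (auto simp: unit_at_def)

lemma consecutive_unit_at:
  assumes "i \<in> points" "j \<in> points"
  shows "consecutive P n (unit_at D i) (unit_at D' j) \<longleftrightarrow>
    cyclic_run P n ((if i \<in> D then {i, nxt i} else {i}) \<union> (if j \<in> D' then {j, nxt j} else {j}))"
proof -
  have "{l \<in> unit_at D i \<union> unit_at D' j. P l} = {l \<in> unit_at D i. P l} \<union> {l \<in> unit_at D' j. P l}"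
    by blast
  then show ?thesis using assms by (simp add: consecutive_def unit_at_P)
qed

lemma consecutive_same_anchor:
  "j \<in> points \<Longrightarrow> consecutive P n {j} {j, mid j, nxt j}"
  using consecutive_unit_at[of j j "{}" "{j}"] cyclic_run_upto_4(1)[of j]
  by (simp add: unit_at_def insert_commute)

lemma consecutive_nxt:
  assumes "j \<in> points"
  shows "consecutive P n (unit_at D j) (unit_at D' (nxt j))"
proof -
  show ?thesis
    using cyclic_run_upto_4[OF assms] assms
    by (auto simp: consecutive_unit_at nxt_points insert_commute)
qed

lemma consecutive_nxt_nxt:
  assumes "j \<in> points" "j \<in> D"
  shows "consecutive P n (unit_at D j) (unit_at D' (nxt (nxt j)))"
  using cyclic_run_upto_4[OF assms(1)] assms
  by (auto simp: consecutive_unit_at nxt_points insert_commute)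

lemma indepD: "J \<in> indep \<Longrightarrow> J \<subseteq> points" "J \<in> indep \<Longrightarrow> j \<in> J \<Longrightarrow> nxt j \<notin> J"
  by (auto simp: indep_def)

text \<open>Independence and freeness keep the point after the far end of each unit outside the
  union. If the union were a run, both far ends would be its unique last element, which is
  impossible for distinct independent anchors.\<close>

lemma not_consecutive:
  assumes J: "J \<in> indep" and D: "D \<subseteq> free_anchors J" and ij: "i \<in> J" "j \<in> J" "i \<noteq> j"
  shows "\<not> consecutive P n (unit_at D i) (unit_at D j)"
proof
  let ?A = "(if i \<in> D then {i, nxt i} else {i}) \<union> (if j \<in> D then {j, nxt j} else {j})"
  let ?last = "\<lambda>i. if i \<in> D then nxt i else i"
  have pts: "i \<in> points" "j \<in> points" using J ij indepD by auto
  have n: "nxt i \<noteq> j" "nxt j \<noteq> i" using J ij indepD(2) by auto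
  have nn: "i \<in> D \<Longrightarrow> nxt (nxt i) \<noteq> j" "j \<in> D \<Longrightarrow> nxt (nxt j) \<noteq> i"
    using D ij by (auto simp: free_anchors_def)
  note facts = pts n nn ij nxt_eq_iff nxt_neq nxt_nxt_neq nxt_points
  assume "consecutive P n (unit_at D i) (unit_at D j)"
  then have "cyclic_run P n ?A" using pts by (simp add: consecutive_unit_at)
  moreover have "?last i \<in> ?A" "?last j \<in> ?A" by auto
  moreover have "nxt (?last i) \<notin> ?A" using facts by (auto split: if_splits)
  moreover have "nxt (?last j) \<notin> ?A" using facts by (auto split: if_splits)
  ultimately have "?last i = ?last j" by (intro cyclic_run_unique_last[of ?A]) auto
  then show False using facts by (auto split: if_splits)
qed

lemma mid_neq: "i \<in> points \<Longrightarrow> j \<in> points \<Longrightarrow> mid i \<noteq> j"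
  using not_P_mid[of i] P_points[of j] by auto

lemma points_in_unit_at:
  "i \<in> points \<Longrightarrow> j \<in> points \<Longrightarrow> i \<in> unit_at D j \<longleftrightarrow> i = j \<or> j \<in> D \<and> i = nxt j"
  using mid_neq[of j i] by (auto simp: unit_at_def)

lemma mid_in_unit_at:
  "i \<in> points \<Longrightarrow> j \<in> points \<Longrightarrow> mid i \<in> unit_at D j \<longleftrightarrow> i = j \<and> j \<in> D"
  using mid_neq[of i j] mid_neq[of i "nxt j"] nxt_points[of j]
  by (simp add: unit_at_def mid_eq_iff)

text \<open>Distinct anchors with the same unit would each be \<open>nxt\<close> of the other, so
  that \<open>nxt (nxt i) = i\<close>.\<close>

lemma inj_on_unit_at: "inj_on (unit_at D) points"
proof (rule inj_onI, rule ccontr)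
  fix i j assume ij: "i \<in> points" "j \<in> points" "i \<noteq> j" and "unit_at D i = unit_at D j"
  then have "nxt j = i" "nxt i = j"
    using points_in_unit_at[of i i D] points_in_unit_at[of j j D]
      points_in_unit_at[of i j D] points_in_unit_at[of j i D] by auto
  with nxt_nxt_neq[of i] ij show False by metis
qed

text \<open>Three clashes have to be avoided: a singleton and a triple at one anchor, anchors
  \<open>j\<close> and \<open>nxt j\<close>, and a triple at \<open>j\<close> with an anchor at
  \<open>nxt (nxt j)\<close>. The first lets \<open>D\<close> determine the unit at each anchor, the
  others are independence and freeness. By \<open>not_consecutive\<close>, avoiding them
  suffices.\<close>

lemma decomposes_iff:
  "decomposes P n U S \<longleftrightarrow>
    (\<exists>J D. J \<in> indep \<and> J \<noteq> {} \<and> D \<subseteq> free_anchors J \<and> U = unit_at D ` J \<and> S = \<Union> U)"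
proof
  assume "decomposes P n U S"
  then have U: "U \<noteq> {}" "U \<subseteq> units P n" "S = \<Union> U"
    and nc: "\<And>u v. u \<in> U \<Longrightarrow> v \<in> U \<Longrightarrow> u \<noteq> v \<Longrightarrow> \<not> consecutive P n u v"
    by (auto simp: decomposes_def)
  define D where "D = {j \<in> points. {j, mid j, nxt j} \<in> U}"
  define J where "J = D \<union> {j \<in> points. {j} \<in> U}"
  have pts: "J \<subseteq> points" by (auto simp: J_def D_def)
  have triple_neq_singleton: "{j, mid j, nxt j} \<noteq> {j}" if "j \<in> points" for j
    using nxt_neq[OF that] by auto
  have in_U: "unit_at D j \<in> U" if "j \<in> J" for j
    using that by (auto simp: J_def D_def unit_at_def)
  have "U \<subseteq> unit_at D ` J"
  proof
    fix u assume u: "u \<in> U"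
    with U(2) consider j where "j \<in> points" "u = {j}" | j where "j \<in> points" "u = {j, mid j, nxt j}"
      unfolding units_eq by blast
    then show "u \<in> unit_at D ` J"
    proof cases
      case 1
      \<comment> \<open>A triple at the same anchor would be consecutive to the singleton, so
        \<open>unit_at D\<close> gives back \<open>{j}\<close>.\<close>
      then have "j \<notin> D"
        using u nc[of "{j}" "{j, mid j, nxt j}"] consecutive_same_anchor triple_neq_singleton
        by (auto simp: D_def)
      with 1 u show ?thesis by (intro image_eqI[of _ _ j]) (auto simp: unit_at_def J_def)
    next
      case 2
      with u show ?thesis by (intro image_eqI[of _ _ j]) (auto simp: unit_at_def J_def D_def)
    qed
  qed
  with in_U have U_eq: "U = unit_at D ` J" by blast
  have neq: "unit_at D i \<noteq> unit_at D j" if "i \<in> points" "j \<in> points" "i \<noteq> j" for i j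
    using that inj_on_unit_at[of D] by (auto dest: inj_onD)
  have "J \<in> indep"
    unfolding indep_def
  proof (intro CollectI conjI ballI pts notI)
    fix j assume j: "j \<in> J" "nxt j \<in> J"
    then have "j \<in> points" "nxt j \<in> points" using pts by auto
    with j show False
      using nc[OF in_U in_U] neq[of j "nxt j"] nxt_neq[of j] consecutive_nxt[of j] by metis
  qed
  moreover have "D \<subseteq> free_anchors J"
    unfolding free_anchors_def
  proof (intro subsetI CollectI conjI notI)
    fix j assume j: "j \<in> D"
    then show "j \<in> J" by (simp add: J_def)
    assume j': "nxt (nxt j) \<in> J"
    have "j \<in> points" "nxt (nxt j) \<in> points" using j j' \<open>j \<in> J\<close> pts by auto
    with j j' \<open>j \<in> J\<close> show False
      using nc[OF in_U in_U] neq[of j "nxt (nxt j)"] nxt_nxt_neq[of j]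
        consecutive_nxt_nxt[of j D D] by metis
  qed
  ultimately show "\<exists>J D. J \<in> indep \<and> J \<noteq> {} \<and> D \<subseteq> free_anchors J \<and> U = unit_at D ` J \<and> S = \<Union> U"
    using U U_eq by blast
next
  assume "\<exists>J D. J \<in> indep \<and> J \<noteq> {} \<and> D \<subseteq> free_anchors J \<and> U = unit_at D ` J \<and> S = \<Union> U"
  then obtain J D where *: "J \<in> indep" "J \<noteq> {}" "D \<subseteq> free_anchors J" "U = unit_at D ` J" "S = \<Union> U"
    by blast
  have "unit_at D j \<in> units P n" if "j \<in> J" for j
    using that indepD(1)[OF *(1)] by (auto simp: units_eq unit_at_def)
  with * not_consecutive[OF *(1,3)] show "decomposes P n U S"
    by (auto simp: decomposes_def)
qed

section \<open>Admissible sets encoded by anchors and triples\<close>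

definition configs :: "nat \<Rightarrow> (int set \<times> int set) set"
  where "configs k = (SIGMA J:{J \<in> indep. card J = k}. Pow (free_anchors J))"

definition cover :: "int set \<times> int set \<Rightarrow> int set"
  where "cover = (\<lambda>(J, D). \<Union> (unit_at D ` J))"

lemma free_anchors_subset: "free_anchors J \<subseteq> J"
  by (auto simp: free_anchors_def)

text \<open>A middle has the wrong parity to be a point and lies in only one triple, so the middles
  in the cover reveal \<open>D\<close>.\<close>

lemma cover_mid:
  assumes "J \<in> indep" "D \<subseteq> free_anchors J"
  shows "D = {j \<in> points. mid j \<in> cover (J, D)}"
proof -
  have pts: "J \<subseteq> points" and "D \<subseteq> J"
    using indepD(1)[OF assms(1)] assms(2) free_anchors_subset[of J] by auto
  moreover have "mid j \<in> cover (J, D) \<longleftrightarrow> j \<in> J \<and> j \<in> D" if "j \<in> points" for j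
    using that pts mid_in_unit_at[of j] by (auto simp: cover_def)
  ultimately show ?thesis by blast
qed

text \<open>Once \<open>D\<close> is known, the points of the cover are the anchors and the far ends
  of the triples; independence keeps these two kinds apart.\<close>

lemma cover_points:
  assumes J: "J \<in> indep" and D: "D \<subseteq> free_anchors J"
  shows "J = {j \<in> points. j \<in> cover (J, D) \<and> j \<notin> nxt ` D}"
proof -
  have pts: "J \<subseteq> points" and DJ: "D \<subseteq> J"
    using indepD(1)[OF J] D free_anchors_subset[of J] by auto
  have "j \<notin> nxt ` D" if "j \<in> J" for j
    using that indepD(2)[OF J] DJ by auto
  moreover have "j \<in> J" if "j \<in> points" "j \<in> cover (J, D)" "j \<notin> nxt ` D" for j
    using that pts by (auto simp: cover_def points_in_unit_at subset_iff)
  moreover have "j \<in> cover (J, D)" if "j \<in> J" for j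
    using that by (auto simp: cover_def unit_at_def)
  ultimately show ?thesis using pts by blast
qed

lemma cover_eqD:
  assumes "J \<in> indep" "D \<subseteq> free_anchors J" "J' \<in> indep" "D' \<subseteq> free_anchors J'"
    and "cover (J, D) = cover (J', D')"
  shows "J = J' \<and> D = D'"
proof -
  have "D = D'"
    using cover_mid[OF assms(1,2)] cover_mid[OF assms(3,4)] assms(5) by simp
  with cover_points[OF assms(1,2)] cover_points[OF assms(3,4)] assms(5) show ?thesis by simp
qed

text \<open>This justifies the \<open>THE\<close> in \<open>units_of_set\<close>: anchors and
  triples can be read off from the set, so all its decompositions come from the same pair.\<close>

lemma units_of_cover:
  assumes "J \<in> indep" "J \<noteq> {}" "D \<subseteq> free_anchors J"
  shows "units_of_set P n (cover (J, D)) = unit_at D ` J"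
  unfolding units_of_set_def
proof (rule the_equality)
  show "decomposes P n (unit_at D ` J) (cover (J, D))"
    using assms by (auto simp: decomposes_iff cover_def)
next
  fix U assume "decomposes P n U (cover (J, D))"
  then obtain J' D' where *: "J' \<in> indep" "D' \<subseteq> free_anchors J'" "U = unit_at D' ` J'"
      "cover (J, D) = cover (J', D')"
    by (auto simp: decomposes_iff cover_def)
  with cover_eqD[OF assms(1,3)] show "U = unit_at D ` J" by blast
qed

lemma finite_indep: "J \<in> indep \<Longrightarrow> finite J"
  using indepD(1) finite_points by (rule finite_subset)

lemma weight_cover:
  assumes "J \<in> indep" "J \<noteq> {}" "D \<subseteq> free_anchors J"
  shows "weight P n (cover (J, D)) = card J"
  unfolding weight_def units_of_cover[OF assms]
  using inj_on_unit_at indepD(1)[OF assms(1)] by (metis card_image inj_on_subset)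

text \<open>The bound \<open>k \<ge> 1\<close> rules out the pair with empty \<open>J\<close>, whose
  cover is empty and hence not admissible.\<close>

lemma bij_betw_cover:
  assumes "k \<ge> 1"
  shows "bij_betw cover (configs k) {S. admissible P n S \<and> weight P n S = k}"
proof (rule bij_betwI')
  fix p q assume "p \<in> configs k" "q \<in> configs k"
  then show "cover p = cover q \<longleftrightarrow> p = q"
    using cover_eqD by (cases p; cases q) (auto simp: configs_def)
next
  fix p assume p: "p \<in> configs k"
  obtain J D where "p = (J, D)" by (cases p)
  with p assms have *: "J \<in> indep" "J \<noteq> {}" "D \<subseteq> free_anchors J" "card J = k"
    by (auto simp: configs_def)
  moreover have "admissible P n (cover p)"
    unfolding admissible_def decomposes_iff \<open>p = (J, D)\<close> cover_def using * by auto
  ultimately show "cover p \<in> {S. admissible P n S \<and> weight P n S = k}"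
    using weight_cover \<open>p = (J, D)\<close> by simp
next
  fix S assume S: "S \<in> {S. admissible P n S \<and> weight P n S = k}"
  then obtain J D where *: "J \<in> indep" "J \<noteq> {}" "D \<subseteq> free_anchors J" "S = cover (J, D)"
    by (auto simp: admissible_def decomposes_iff cover_def)
  with S weight_cover[OF *(1-3)] show "\<exists>p\<in>configs k. S = cover p"
    by (intro bexI[of _ "(J, D)"]) (auto simp: configs_def)
qed

section \<open>Sign and monomial of a cover\<close>

lemma sgn_cover:
  assumes J: "J \<in> indep" "J \<noteq> {}" and D: "D \<subseteq> free_anchors J"
  shows "sgn_of_set P n (cover (J, D)) = ((-1) ^ card (J - D) :: 'b::comm_ring_1)"
proof -
  have pts: "J \<subseteq> points" using indepD J by blast
  have "is_singleton (unit_at D j) \<longleftrightarrow> j \<notin> D" if "j \<in> J" for j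
    using mid_neq[of j j] that pts by (auto simp: unit_at_def is_singleton_def)
  then have "{u \<in> unit_at D ` J. is_singleton u} = unit_at D ` (J - D)"
    by auto
  moreover have "card (unit_at D ` (J - D)) = card (J - D)"
    by (rule card_image, rule inj_on_subset[OF inj_on_unit_at]) (use pts in auto)
  ultimately show ?thesis by (simp add: sgn_of_set_def units_of_cover[OF assms])
qed

lemma prod_cover:
  fixes x :: "int \<Rightarrow> 'b::comm_ring_1"
  assumes J: "J \<in> indep" "J \<noteq> {}" and D: "D \<subseteq> free_anchors J"
  shows "(\<Prod>i\<in>cover (J, D). x i) = (\<Prod>j\<in>J. x j) * (\<Prod>j\<in>D. x (mid j) * x (nxt j))"
proof -
  have pts: "J \<subseteq> points" and DJ: "D \<subseteq> J"
    using indepD(1)[OF J(1)] D free_anchors_subset[of J] by auto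
  have disj: "unit_at D i \<inter> unit_at D j = {}" if ij: "i \<in> J" "j \<in> J" "i \<noteq> j" for i j
  proof (intro equals0I, elim IntE)
    fix l assume l: "l \<in> unit_at D i" "l \<in> unit_at D j"
    have ij_pts: "i \<in> points" "j \<in> points" using ij pts by auto
    \<comment> \<open>A shared middle forces equal anchors; a shared point forces equal anchors or
      makes one anchor \<open>nxt\<close> of the other, against independence.\<close>
    from l(1) ij_pts consider "l = mid i" | "l \<in> points"
      using nxt_points[of i] by (auto simp: unit_at_def split: if_splits)
    then show False
    proof cases
      case 1
      with l ij ij_pts show False by (simp add: mid_in_unit_at)
    next
      case 2
      with l ij ij_pts show False
        using indepD(2)[OF J(1), of i] indepD(2)[OF J(1), of j]
        by (auto simp: points_in_unit_at nxt_eq_iff)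
    qed
  qed
  have "finite J" "\<forall>j\<in>J. finite (unit_at D j)"
    using finite_indep[OF J(1)] by (auto simp: unit_at_def)
  then have "(\<Prod>i\<in>cover (J, D). x i) = (\<Prod>j\<in>J. \<Prod>i\<in>unit_at D j. x i)"
    using disj by (simp add: cover_def prod.UNION_disjoint)
  also have "\<dots> = (\<Prod>j\<in>J. x j * (if j \<in> D then x (mid j) * x (nxt j) else 1))"
  proof (rule prod.cong[OF refl])
    fix j assume "j \<in> J"
    then have "j \<in> points" using pts by blast
    then have "j \<noteq> mid j" "j \<noteq> nxt j" "mid j \<noteq> nxt j"
      using mid_neq[of j] nxt_neq[of j] nxt_points[of j] by metis+
    then show "(\<Prod>i\<in>unit_at D j. x i) = x j * (if j \<in> D then x (mid j) * x (nxt j) else 1)"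
      by (simp add: unit_at_def)
  qed
  also have "\<dots> = (\<Prod>j\<in>J. x j) * (\<Prod>j\<in>D. x (mid j) * x (nxt j))"
    using DJ \<open>finite J\<close>
    by (simp add: prod.distrib prod.If_cases Int_absorb1)
  finally show ?thesis .
qed

text \<open>
  For fixed anchors \<open>J\<close>, each free anchor independently carries either a singleton or a triple, so
  the sum over the choices of triples factors.
\<close>

lemma pent_inv_eq_sum_indep:
  fixes x :: "int \<Rightarrow> 'b::comm_ring_1"
  assumes k: "k \<ge> 1" "k \<noteq> n"
  shows "pent_inv P n k x =
    (\<Sum>J | J \<in> indep \<and> card J = k.
      (\<Prod>j\<in>J. - x j) * (\<Prod>j\<in>free_anchors J. 1 - x (mid j) * x (nxt j)))"
proof -
  let ?w = "\<lambda>j. x (mid j) * x (nxt j)"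
  have fin: "finite {J \<in> indep. card J = k}"
    by (rule finite_subset[of _ "Pow points"]) (auto simp: indep_def)
  have "pent_inv P n k x = (\<Sum>p\<in>configs k. sgn_of_set P n (cover p) * (\<Prod>i\<in>cover p. x i))"
    unfolding pent_inv_def using k(2) by (simp add: sum.reindex_bij_betw[OF bij_betw_cover[OF k(1)], symmetric])
  also have "\<dots> = (\<Sum>(J, D)\<in>configs k. (\<Prod>j\<in>J. - x j) * (\<Prod>j\<in>D. - ?w j))"
  proof (rule sum.cong[OF refl])
    fix p assume p: "p \<in> configs k"
    obtain J D where [simp]: "p = (J, D)" by (cases p)
    from p k have *: "J \<in> indep" "J \<noteq> {}" "D \<subseteq> free_anchors J"
      by (auto simp: configs_def)
    then have "D \<subseteq> J" using free_anchors_subset by blast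
    then have "card J = card (J - D) + card D"
      using finite_indep[OF *(1)] by (simp add: card_Diff_subset card_mono finite_subset)
    \<comment> \<open>One sign goes to every anchor and a second one, undoing it, to every triple;
      this yields the factors \<open>- x j\<close> and \<open>- ?w j\<close>.\<close>
    then have "(-1) ^ card (J - D) = ((-1) ^ card J * (-1) ^ card D :: 'b)"
      by (simp add: power_add mult.assoc flip: power_mult_distrib)
    then show "sgn_of_set P n (cover p) * (\<Prod>i\<in>cover p. x i) =
        (case p of (J, D) \<Rightarrow> (\<Prod>j\<in>J. - x j) * (\<Prod>j\<in>D. - ?w j))"
      by (simp add: sgn_cover[OF *] prod_cover[OF *] prod_uminus mult_ac)
  qed
  also have "\<dots> = (\<Sum>J | J \<in> indep \<and> card J = k. \<Sum>D\<in>Pow (free_anchors J).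
      (\<Prod>j\<in>J. - x j) * (\<Prod>j\<in>D. - ?w j))"
    unfolding configs_def
    by (rule sum.Sigma[symmetric, OF fin])
      (auto intro: finite_subset[OF free_anchors_subset] finite_indep)
  also have "\<dots> = (\<Sum>J | J \<in> indep \<and> card J = k.
      (\<Prod>j\<in>J. - x j) * (\<Prod>j\<in>free_anchors J. 1 - ?w j))"
  proof (rule sum.cong[OF refl])
    fix J assume "J \<in> {J \<in> indep. card J = k}"
    then have "finite (free_anchors J)"
      by (auto intro: finite_subset[OF free_anchors_subset] finite_indep)
    \<comment> \<open>Expanding the product picks \<open>- ?w j\<close> at the anchors in
      \<open>D\<close> and \<open>1\<close> at the remaining free anchors.\<close>
    then have "(\<Prod>j\<in>free_anchors J. - ?w j + 1) =
        (\<Sum>D\<in>Pow (free_anchors J). (\<Prod>j\<in>D. - ?w j))"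
      by (subst prod_add) simp_all
    then show "(\<Sum>D\<in>Pow (free_anchors J). (\<Prod>j\<in>J. - x j) * (\<Prod>j\<in>D. - ?w j)) =
        (\<Prod>j\<in>J. - x j) * (\<Prod>j\<in>free_anchors J. 1 - ?w j)"
      by (simp flip: sum_distrib_left)
  qed
  finally show ?thesis .
qed

lemma pent_inv_top: "pent_inv P n n x = (\<Prod>j\<in>points. x j)"
  by (simp add: pent_inv_def points_def)

end

subsection \<open>The effect of the maps\<close>

text \<open>Telescoping: \<open>f\<close>, with inverse \<open>g\<close>, maps the elements with
  \<open>f j \<in> J\<close> onto those with \<open>g j \<in> J\<close>, so these denominators
  cancel these numerators. The second product cancels the remaining denominators.\<close>

lemma prod_quotient_shift:
  fixes c :: "'a \<Rightarrow> 'b::field"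
  assumes "finite J" and nz: "\<And>j. j \<in> J \<Longrightarrow> c (f j) \<noteq> 0"
    and gf: "\<And>j. j \<in> J \<Longrightarrow> g (f j) = j" and fg: "\<And>j. j \<in> J \<Longrightarrow> f (g j) = j"
  shows "(\<Prod>j\<in>J. c j / c (f j)) * (\<Prod>j | j \<in> J \<and> f j \<notin> J. c (f j)) = (\<Prod>j | j \<in> J \<and> g j \<notin> J. c j)"
proof -
  have split: "(\<Prod>j\<in>J. h j) = (\<Prod>j | j \<in> J \<and> p j. h j) * (\<Prod>j | j \<in> J \<and> \<not> p j. h j)"
    for h :: "'a \<Rightarrow> 'b" and p
    using prod.union_disjoint[of "{j \<in> J. p j}" "{j \<in> J. \<not> p j}" h] \<open>finite J\<close>
    by (simp add: Collect_disj_eq[symmetric] conj_disj_distribL[symmetric] disjoint_iff)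
  have "(\<Prod>j | j \<in> J \<and> f j \<in> J. c (f j)) = (\<Prod>j | j \<in> J \<and> g j \<in> J. c j)"
    by (rule prod.reindex_bij_witness[of _ g f]) (auto simp: gf fg)
  moreover have "(\<Prod>j | j \<in> J \<and> f j \<in> J. c (f j)) \<noteq> 0" "(\<Prod>j | j \<in> J \<and> f j \<notin> J. c (f j)) \<noteq> 0"
    using nz \<open>finite J\<close> by auto
  ultimately show ?thesis
    unfolding prod_dividef split[of c "\<lambda>j. g j \<in> J"] split[of "\<lambda>j. c (f j)" "\<lambda>j. f j \<in> J"]
    by (simp add: field_simps)
qed

text \<open>
  Both maps have this form, with opposite signs of \<open>s\<close> at odd and at even positions; \<open>\<alpha>\<^sub>1\<close> and
  \<open>\<alpha>\<^sub>2\<close> differ only in which parity gets \<open>s = 1\<close>.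
\<close>

definition swap_value :: "nat \<Rightarrow> int \<Rightarrow> (int \<Rightarrow> 'b::field) \<Rightarrow> int \<Rightarrow> 'b"
  where "swap_value n s x j = x (cyc n (j + s)) *
    ((1 - x (cyc n (j + 2 * s)) * x (cyc n (j + 3 * s))) /
     (1 - x (cyc n (j - s)) * x (cyc n (j - 2 * s))))"

lemma swap_value_cyc [simp]: "swap_value n s x (cyc n j) = swap_value n s x j"
  by (simp add: swap_value_def)

lemma alpha1_eq_swap_value: "alpha1 n x j = swap_value n (if odd j then 1 else - 1) x j"
  by (auto simp: alpha1_def swap_value_def Let_def mult.commute algebra_simps elim!: oddE evenE)

lemma alpha2_eq_swap_value: "alpha2 n x j = swap_value n (if odd j then - 1 else 1) x j"
  by (auto simp: alpha2_def swap_value_def Let_def mult.commute algebra_simps elim!: oddE evenE)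

section \<open>Exchange of the two parities\<close>

context oriented_cycle
begin

text \<open>Serves both maps and both parities: \<open>s\<close> is the sign that the map uses at
  positions in \<open>P\<close>. The tuple may lie in any field, and \<open>nz\<close> keeps all
  denominators nonzero.\<close>

lemma pent_inv_swap:
  fixes x y :: "int \<Rightarrow> 'b::field"
  assumes nz: "\<And>i j. 1 - x i * x j \<noteq> 0"
    and y_P: "\<And>j. P j \<Longrightarrow> y j = swap_value n s x j"
    and y_not_P: "\<And>j. \<not> P j \<Longrightarrow> y j = swap_value n (- s) x j"
    and k: "k \<ge> 1"
  shows "pent_inv P n k y = pent_inv (\<lambda>i. \<not> P i) n k x"
proof -
  have "(\<lambda>i. \<not> P i) = even" if "P = odd" unfolding that by simp
  moreover have "(\<lambda>i. \<not> P i) = odd" if "P = even" unfolding that by simp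
  ultimately have parity_opp: "(\<lambda>i. \<not> P i) = odd \<or> (\<lambda>i. \<not> P i) = even"
    using parity by argo
  have step_rev: "- s = 1 \<or> - s = -1"
    using step by linarith
  interpret rev: oriented_cycle n "- s" P
    using n_ge_3 step_rev parity by (rule oriented_cycle.intro)
  interpret opp: oriented_cycle n s "\<lambda>i. \<not> P i"
    using n_ge_3 step parity_opp by (rule oriented_cycle.intro)
  \<comment> \<open>\<open>c j\<close> is the triple factor of \<open>x\<close> at the shifted
    anchor \<open>mid j\<close>, and \<open>c (j - 4 * s)\<close> is the denominator of
    \<open>swap_value n s x j\<close>, up to reduction of indices.\<close>
  define c where "c j = 1 - x (cyc n (j + 2 * s)) * x (cyc n (j + 3 * s))" for j
  have rev_nxt_nxt: "rev.nxt (rev.nxt j) = cyc n (j - 4 * s)" for j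
    by (simp add: rev.nxt_nxt)
  have rev_inverse: "rev.nxt (nxt j) = j" "nxt (rev.nxt j) = j" if "j \<in> points" for j
    using points_cyc[OF that] by (simp_all add: nxt_def rev.nxt_def)
  \<comment> \<open>Independence does not depend on the orientation, since \<open>rev.nxt\<close>
    inverts \<open>nxt\<close>.\<close>
  have indep_eq: "rev.indep = indep"
  proof -
    have "(\<forall>j\<in>J. rev.nxt j \<notin> J) \<longleftrightarrow> (\<forall>j\<in>J. nxt j \<notin> J)" if "J \<subseteq> points" for J
    proof (intro iffI ballI notI)
      fix j assume *: "\<forall>j\<in>J. rev.nxt j \<notin> J" "j \<in> J" "nxt j \<in> J"
      then have "rev.nxt (nxt j) \<notin> J" "rev.nxt (nxt j) = j"
        using that by (blast, intro rev_inverse, blast)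
      with * show False by simp
    next
      fix j assume *: "\<forall>j\<in>J. nxt j \<notin> J" "j \<in> J" "rev.nxt j \<in> J"
      then have "nxt (rev.nxt j) \<notin> J" "nxt (rev.nxt j) = j"
        using that by (blast, intro rev_inverse, blast)
      with * show False by simp
    qed
    then show ?thesis unfolding indep_def rev.indep_def by blast
  qed
  have y: "y j = x (mid j) * (c j / c (rev.nxt (rev.nxt j)))" if "j \<in> points" for j
    using y_P[OF P_points[OF that]]
    by (simp add: swap_value_def rev_nxt_nxt c_def mid_def mult.commute)
  \<comment> \<open>The two values of \<open>y\<close> sit at neighbouring positions of opposite
    parity, and their quotients \<open>?u / ?v\<close> and \<open>?v / ?u\<close> are reciprocal.
    This is why \<open>y\<close> is expanded with orientation \<open>- s\<close>.\<close>
  have yy: "1 - y (rev.mid j) * y (rev.nxt j) = c (rev.nxt (rev.nxt j))" if "j \<in> points" for j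
  proof -
    let ?u = "1 - x (cyc n j) * x (cyc n (j + s))"
    let ?v = "1 - x (cyc n (j - 3 * s)) * x (cyc n (j - 4 * s))"
    have "y (rev.nxt j) = swap_value n s x (j - 2 * s)"
      using y_P[OF P_points[OF rev.nxt_points[of j]]] that by (simp add: rev.nxt_def)
    also have "\<dots> = x (cyc n (j - s)) * (?u / ?v)"
      by (simp add: swap_value_def algebra_simps)
    finally have "y (rev.nxt j) = x (cyc n (j - s)) * (?u / ?v)" .
    moreover have "y (rev.mid j) = x (cyc n (j - 2 * s)) * (?v / ?u)"
    proof -
      have "y (rev.mid j) = swap_value n (- s) x (j - s)"
        using y_not_P[OF rev.not_P_mid[of j]] that by (simp add: rev.mid_def)
      then show ?thesis
        by (simp add: swap_value_def algebra_simps)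
    qed
    moreover have "?u \<noteq> 0" "?v \<noteq> 0" by (rule nz)+
    ultimately have "y (rev.mid j) * y (rev.nxt j) = x (cyc n (j - 2 * s)) * x (cyc n (j - s))"
      by simp
    then show ?thesis by (simp add: c_def rev_nxt_nxt)
  qed
  \<comment> \<open>Telescoping along steps of 4: \<open>f\<close> goes back by \<open>4 * s\<close>
    and \<open>g\<close> forward by \<open>4 * s\<close>.\<close>
  have cancel: "(\<Prod>j\<in>J. c j / c (rev.nxt (rev.nxt j))) *
      (\<Prod>j\<in>rev.free_anchors J. c (rev.nxt (rev.nxt j))) = (\<Prod>j\<in>free_anchors J. c j)"
    if J: "J \<subseteq> points" for J
    unfolding free_anchors_def rev.free_anchors_def
  proof (rule prod_quotient_shift)
    show "finite J" using J finite_points by (rule finite_subset)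
    show "c (rev.nxt (rev.nxt j)) \<noteq> 0" for j unfolding c_def by (rule nz)
    show "nxt (nxt (rev.nxt (rev.nxt j))) = j" "rev.nxt (rev.nxt (nxt (nxt j))) = j" if "j \<in> J" for j
      using subsetD[OF J that] by (simp_all add: rev_inverse nxt_points rev.nxt_points)
  qed
  have bij_mid: "bij_betw mid points opp.points"
  proof (rule bij_betw_byWitness[where f' = "\<lambda>j. cyc n (j - s)"])
    show "mid ` points \<subseteq> opp.points"
      using opp.cyc_points P_step P_points by (auto simp: mid_def)
    show "(\<lambda>j. cyc n (j - s)) ` opp.points \<subseteq> points"
    proof (rule image_subsetI)
      fix j assume "j \<in> opp.points"
      then show "cyc n (j - s) \<in> points"
        using opp.P_points[of j] P_step[of "j - s"] by (intro cyc_points) simp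
    qed
  qed (auto simp: mid_def points_cyc opp.points_cyc)
  then have inj_mid: "inj_on mid points" by (simp add: bij_betw_def)
  have opp_nxt: "opp.nxt (mid j) = mid (nxt j)" for j
    by (simp add: opp.nxt_def nxt_def mid_def algebra_simps)
  have mid_image_iff: "mid i \<in> mid ` J \<longleftrightarrow> i \<in> J" if "i \<in> points" "J \<subseteq> points" for i J
    using inj_on_image_mem_iff[OF inj_mid that] .
  show ?thesis
  proof (cases "k = n")
    case True
    have "(\<Prod>j\<in>points. y j) = (\<Prod>j\<in>points. x (mid j)) * (\<Prod>j\<in>points. c j / c (rev.nxt (rev.nxt j)))"
      by (simp add: y flip: prod.distrib)
    \<comment> \<open>\<open>points\<close> is not independent, but \<open>cancel\<close> holds for
      it; with no free anchors on either side, the quotients multiply to 1.\<close>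
    moreover have "free_anchors points = {}" "rev.free_anchors points = {}"
      using nxt_points rev.nxt_points by (auto simp: free_anchors_def rev.free_anchors_def)
    ultimately have "(\<Prod>j\<in>points. y j) = (\<Prod>j\<in>points. x (mid j))"
      using cancel[of points] by simp
    also have "\<dots> = (\<Prod>j\<in>opp.points. x j)"
      by (rule prod.reindex_bij_betw[OF bij_mid])
    finally show ?thesis by (simp add: True pent_inv_top opp.pent_inv_top)
  next
    case False
    \<comment> \<open>The shift \<open>mid\<close> commutes with the \<open>nxt\<close> maps of both
      parities, so it carries independent sets to independent sets of the same size.\<close>
    have "bij_betw ((`) mid) {J \<in> indep. card J = k} {J \<in> opp.indep. card J = k}"
    proof -
      have pow: "bij_betw ((`) mid) (Pow points) (Pow opp.points)"
        using bij_mid by (rule bij_betw_Pow)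
      have eq: "mid ` J \<in> opp.indep \<and> card (mid ` J) = k \<longleftrightarrow> J \<in> indep \<and> card J = k"
        if J: "J \<subseteq> points" for J
      proof -
        have "card (mid ` J) = card J"
          using inj_mid J by (metis card_image inj_on_subset)
        moreover have "mid ` J \<subseteq> opp.points"
          using bij_mid J by (auto simp: bij_betw_def)
        moreover have "mid (nxt j) \<in> mid ` J \<longleftrightarrow> nxt j \<in> J" if "j \<in> J" for j
          using that J by (intro mid_image_iff nxt_points) auto
        ultimately show ?thesis
          using J by (simp add: indep_def opp.indep_def opp_nxt)
      qed
      have img: "(`) mid ` {J \<in> indep. card J = k} = {J \<in> opp.indep. card J = k}"
      proof (intro equalityI subsetI)
        fix J' assume J': "J' \<in> {J \<in> opp.indep. card J = k}"
        then have "J' \<in> (`) mid ` Pow points"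
          by (auto simp: bij_betw_imp_surj_on[OF pow] opp.indep_def)
        then obtain J where "J \<subseteq> points" "J' = mid ` J" by blast
        with J' eq show "J' \<in> (`) mid ` {J \<in> indep. card J = k}" by auto
      next
        fix J' assume "J' \<in> (`) mid ` {J \<in> indep. card J = k}"
        then obtain J where "J \<in> indep" "card J = k" "J' = mid ` J" by auto
        then show "J' \<in> {J \<in> opp.indep. card J = k}"
          using eq[OF indepD(1)[OF \<open>J \<in> indep\<close>]] by simp
      qed
      show ?thesis
        by (rule bij_betw_subset[OF pow _ img]) (auto simp: indep_def)
    qed
    note reindex = sum.reindex_bij_betw[OF this, symmetric]
    have "pent_inv P n k y = (\<Sum>J | J \<in> indep \<and> card J = k.
        (\<Prod>j\<in>J. - y j) * (\<Prod>j\<in>rev.free_anchors J. 1 - y (rev.mid j) * y (rev.nxt j)))"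
      using rev.pent_inv_eq_sum_indep[OF k False] by (simp add: indep_eq)
    also have "\<dots> = (\<Sum>J | J \<in> indep \<and> card J = k.
        (\<Prod>j\<in>mid ` J. - x j) * (\<Prod>j\<in>opp.free_anchors (mid ` J). 1 - x (opp.mid j) * x (opp.nxt j)))"
    proof (rule sum.cong[OF refl])
      fix J assume "J \<in> {J. J \<in> indep \<and> card J = k}"
      then have J: "J \<subseteq> points" using indepD by blast
      have free: "free_anchors J \<subseteq> points" "rev.free_anchors J \<subseteq> points"
        using J by (auto simp: free_anchors_def rev.free_anchors_def)
      have "(\<Prod>j\<in>J. - y j) = (\<Prod>j\<in>J. - x (mid j)) * (\<Prod>j\<in>J. c j / c (rev.nxt (rev.nxt j)))"
        unfolding prod.distrib[symmetric] using J by (intro prod.cong) (auto simp: y)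
      moreover have "(\<Prod>j\<in>rev.free_anchors J. 1 - y (rev.mid j) * y (rev.nxt j)) =
          (\<Prod>j\<in>rev.free_anchors J. c (rev.nxt (rev.nxt j)))"
        using free by (intro prod.cong) (auto simp: yy)
      ultimately have "(\<Prod>j\<in>J. - y j) * (\<Prod>j\<in>rev.free_anchors J. 1 - y (rev.mid j) * y (rev.nxt j)) =
          (\<Prod>j\<in>J. - x (mid j)) * (\<Prod>j\<in>free_anchors J. c j)"
        by (simp add: cancel[OF J] mult.assoc)
      moreover have "(\<Prod>j\<in>mid ` J. - x j) = (\<Prod>j\<in>J. - x (mid j))"
        using inj_on_subset[OF inj_mid J] by (simp add: prod.reindex)
      moreover have "(\<Prod>j\<in>opp.free_anchors (mid ` J). 1 - x (opp.mid j) * x (opp.nxt j)) =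
          (\<Prod>j\<in>free_anchors J. c j)"
      proof -
        have "opp.free_anchors (mid ` J) = mid ` {j \<in> J. mid (nxt (nxt j)) \<notin> mid ` J}"
          by (auto simp: opp.free_anchors_def opp_nxt)
        also have "{j \<in> J. mid (nxt (nxt j)) \<notin> mid ` J} = free_anchors J"
          unfolding free_anchors_def
        proof (intro Collect_cong conj_cong refl arg_cong[where f = Not])
          fix j assume "j \<in> J"
          then show "mid (nxt (nxt j)) \<in> mid ` J \<longleftrightarrow> nxt (nxt j) \<in> J"
            using J by (intro mid_image_iff nxt_points) auto
        qed
        finally have "opp.free_anchors (mid ` J) = mid ` free_anchors J" .
        moreover have "1 - x (opp.mid (mid j)) * x (opp.nxt (mid j)) = c j" for j
        proof -
          have "opp.mid (mid j) = cyc n (j + 2 * s)" "opp.nxt (mid j) = cyc n (j + 3 * s)"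
            by (simp_all add: mid_def nxt_def algebra_simps)
          then show ?thesis by (simp add: c_def)
        qed
        ultimately show ?thesis
          using inj_on_subset[OF inj_mid free(1)] by (simp add: prod.reindex)
      qed
      ultimately show "(\<Prod>j\<in>J. - y j) * (\<Prod>j\<in>rev.free_anchors J. 1 - y (rev.mid j) * y (rev.nxt j)) =
          (\<Prod>j\<in>mid ` J. - x j) * (\<Prod>j\<in>opp.free_anchors (mid ` J). 1 - x (opp.mid j) * x (opp.nxt j))"
        by simp
    qed
    also have "\<dots> = (\<Sum>J | J \<in> opp.indep \<and> card J = k.
        (\<Prod>j\<in>J. - x j) * (\<Prod>j\<in>opp.free_anchors J. 1 - x (opp.mid j) * x (opp.nxt j)))"
      by (rule reindex[symmetric])
    also have "\<dots> = pent_inv (\<lambda>i. \<not> P i) n k x"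
      by (rule opp.pent_inv_eq_sum_indep[OF k False, symmetric])
    finally show ?thesis .
  qed
qed

end

theorem theorem1p1:
  fixes n k :: nat
  assumes "n \<ge> 3"
    and "k \<in> {1..n div 2} \<union> {n}"
  shows "(pent_O n k \<circ> alpha1 n) indet = (pent_E n k indet :: 'a::field ratfun) \<and>
     (pent_E n k \<circ> alpha1 n) indet = (pent_O n k indet :: 'a::field ratfun) \<and>
     (pent_O n k \<circ> alpha2 n) indet = (pent_E n k indet :: 'a::field ratfun) \<and>
     (pent_E n k \<circ> alpha2 n) indet = (pent_O n k indet :: 'a::field ratfun)"
proof -
  have k: "k \<ge> 1" using assms by auto
  have cycles: "oriented_cycle n s odd" "oriented_cycle n s even" if "s = 1 \<or> s = -1" for s
    using assms(1) that by (auto intro: oriented_cycle.intro)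
  have nz: "1 - indet i * indet j \<noteq> (0 :: 'a ratfun)" for i j
    by (rule one_minus_indet_mult_indet_neq_0)
  have swap: "pent_inv odd n k y = pent_inv even n k indet \<and>
      pent_inv even n k y = pent_inv odd n k indet"
    if "s = 1 \<or> s = -1" "\<And>j. y j = swap_value n (if odd j then s else - s) indet j"
    for s and y :: "int \<Rightarrow> 'a ratfun"
  proof
    show "pent_inv odd n k y = pent_inv even n k indet"
      using oriented_cycle.pent_inv_swap[OF cycles(1)[OF that(1)] _ _ _ k, of indet y] that(2) nz by simp
    \<comment> \<open>At even positions the map uses the sign \<open>- s\<close>, so the parity
      \<open>even\<close> is paired with the orientation \<open>- s\<close>.\<close>
    show "pent_inv even n k y = pent_inv odd n k indet"
      using oriented_cycle.pent_inv_swap[OF cycles(2)[of "- s"] _ _ _ k, of indet y] that nz by auto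
  qed
  show ?thesis
    using swap[of 1 "alpha1 n indet"] swap[of "-1" "alpha2 n indet"]
    by (simp add: pent_O_def pent_E_def alpha1_eq_swap_value alpha2_eq_swap_value)
qed

end
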